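(* Let $F(\cdot;\theta)$, $\theta\in\Theta$, be an exponential family of the first type with functions $A$ and $B$. Suppose a random sample $(X_1,\dots,X_n)$ from $F(\cdot;\theta)$ has $m$ upper record values $(R_1,\dots,R_m)$. Then the maximum likelihood estimators of the PDF and of the CDF based on the upper record values $R_1,\dots,R_m$ have the same distributions as the corresponding maximum likelihood estimators based on a random sample of size $m$. That is, for each $x$, and with $(X_1,\dots,X_m)$ denoting a random sample of size $m$ from $F(\cdot;\theta)$, $\hat f_{MLE,(R_1,\dots,R_m)}(x)$ and $\hat f_{MLE,(X_1,\dots,X_m)}(x)$ are identically distributed, and $\hat F_{MLE,(R_1,\dots,R_m)}(x)$ and $\hat F_{MLE,(X_1,\dots,X_m)}(x)$ are identically distributed.
   Context: Exponential family of the first type: the family of distributions with cumulative distribution function $F(x;\theta)=1-\exp\{-B(\theta)A(x)\}$ for $x\in[a,b]$, where $A$ is an increasing differentiable function with $A(a)=0$, $A(b)=+\infty$ ($b=+\infty$ is allowed), and $B(\theta)>0$. The density is $f(x;\theta)=A'(x)B(\theta)\exp\{-A(x)B(\theta)\}$. The parameter set $\Theta\subseteq\mathbb{R}$ is an interval and $B:\Theta\to\mathbb{R}$ is twice differentiable and one-to-one. A random sample is an i.i.d. sample. Upper record values: $R_1=X_1$, and subsequent upper records are the successive observations that exceed all previous observations. The joint density of the $m$ upper record values $R_1,\dots,R_m$ is taken to be $f(r_m;\theta)\prod_{i=1}^{m-1}h(r_i;\theta)=B^m(\theta)\left\{\prod_{i=1}^mA'(r_i)\right\}\exp\{-B(\theta)A(r_m)\}$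 for $r_1<\dots<r_m$, where $h=f/(1-F)$; in particular $A(R_m)$ has the Gamma distribution with shape $m$ and scale $1/B(\theta)$. Estimators (for fixed $x$): for a random sample of size $k$, $\hat f_{MLE,(X_1,\dots,X_k)}(x)=\frac{kA'(x)}{\sum_{i=1}^kA(X_i)}\exp\left(-\frac{kA(x)}{\sum_{i=1}^kA(X_i)}\right)$ and $\hat F_{MLE,(X_1,\dots,X_k)}(x)=1-\exp\left(-\frac{kA(x)}{\sum_{i=1}^kA(X_i)}\right)$; based on upper records, $\hat f_{MLE,(R_1,\dots,R_m)}(x)=\frac{mA'(x)}{A(R_m)}\exp\left(-\frac{mA(x)}{A(R_m)}\right)$ and $\hat F_{MLE,(R_1,\dots,R_m)}(x)=1-\exp\left(-\frac{mA(x)}{A(R_m)}\right)$. *)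

theory Defs
  imports "HOL-Probability.Probability"
begin

text \<open>
  The support is the set of reals \<open>x\<close> with \<open>a \<le> x < b\<close>; the upper end point is an extended real so that
  \<open>b = \<infinity>\<close> is allowed, and \<open>A(b) = +\<infinity>\<close> is read as a limit from the left. The function \<open>A'\<close> is the
  derivative of \<open>A\<close>. At the end point \<open>a\<close> only continuity is required, so that the Weibull case
  \<open>A x = x powr c\<close> with \<open>c < 1\<close> is included; \<open>A' a\<close> may be the one-sided derivative if there is one.
  The values of \<open>A\<close> off the support are immaterial; Borel measurability there ensures that
  \<open>A(X)\<close> is a random variable although \<open>X\<close> may leave the support on a null set.
\<close>

locale exp_family_first_type =
  fixes a :: real and b :: ereal and A A' :: "real \<Rightarrow> real"
    and \<Theta> :: "real set" and B :: "real \<Rightarrow> real"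
  assumes a_less_b: "ereal a < b"
    and A_measurable: "A \<in> borel_measurable borel"
    and A_mono: "mono_on {x. a \<le> x \<and> ereal x < b} A"
    and A_deriv: "\<And>x. a < x \<Longrightarrow> ereal x < b \<Longrightarrow> (A has_real_derivative A' x) (at x)"
    and A_cont: "continuous (at_right a) A"
    and A_left: "A a = 0"
    and A_right: "filterlim (A \<circ> real_of_ereal) at_top (at_left b)"
    and Theta_interval: "is_interval \<Theta>"
    and B_pos: "\<And>\<theta>. \<theta> \<in> \<Theta> \<Longrightarrow> 0 < B \<theta>"
    and B_inj: "inj_on B \<Theta>"
    and B_twice_diff: "\<exists>B' B''. \<forall>\<theta>\<in>\<Theta>. (B has_real_derivative B' \<theta>) (at \<theta> within \<Theta>) \<and>
                                  (B' has_real_derivative B'' \<theta>) (at \<theta> within \<Theta>)"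

definition ef_cdf :: "real \<Rightarrow> ereal \<Rightarrow> (real \<Rightarrow> real) \<Rightarrow> (real \<Rightarrow> real) \<Rightarrow> real \<Rightarrow> real \<Rightarrow> real" where
  "ef_cdf a b A B \<theta> x =
     (if x < a then 0 else if ereal x < b then 1 - exp (- (B \<theta> * A x)) else 1)"

definition ef_pdf :: "real \<Rightarrow> ereal \<Rightarrow> (real \<Rightarrow> real) \<Rightarrow> (real \<Rightarrow> real) \<Rightarrow> (real \<Rightarrow> real) \<Rightarrow> real \<Rightarrow> real \<Rightarrow> real" where
  "ef_pdf a b A A' B \<theta> x =
     (if a \<le> x \<and> ereal x < b then A' x * B \<theta> * exp (- (A x * B \<theta>)) else 0)"

definition ef_hazard :: "real \<Rightarrow> ereal \<Rightarrow> (real \<Rightarrow> real) \<Rightarrow> (real \<Rightarrow> real) \<Rightarrow> (real \<Rightarrow> real) \<Rightarrow> real \<Rightarrow> real \<Rightarrow> real" where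
  "ef_hazard a b A A' B \<theta> x = ef_pdf a b A A' B \<theta> x / (1 - ef_cdf a b A B \<theta> x)"

definition random_sample :: "'w measure \<Rightarrow> (real \<Rightarrow> real) \<Rightarrow> nat \<Rightarrow> (nat \<Rightarrow> 'w \<Rightarrow> real) \<Rightarrow> bool" where
  "random_sample M F k X \<longleftrightarrow>
     prob_space M \<and>
     prob_space.indep_vars M (\<lambda>_. borel) X {1..k} \<and>
     (\<forall>i\<in>{1..k}. cdf (distr M borel (X i)) = F)"

text \<open>The first entry of a nonempty list is always a record.\<close>

definition upper_records :: "real list \<Rightarrow> real list" where
  "upper_records xs =
     map (\<lambda>i. xs ! i) (filter (\<lambda>i. \<forall>j<i. xs ! j < xs ! i) [0..<length xs])"

definition record_density ::
    "real \<Rightarrow> ereal \<Rightarrow> (real \<Rightarrow> real) \<Rightarrow> (real \<Rightarrow> real) \<Rightarrow> (real \<Rightarrow> real) \<Rightarrow> real \<Rightarrow> nat \<Rightarrow> (nat \<Rightarrow> real) \<Rightarrow> real" where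
  "record_density a b A A' B \<theta> m r =
     (if strict_mono_on {1..m} r
      then ef_pdf a b A A' B \<theta> (r m) * (\<Prod>i\<in>{1..<m}. ef_hazard a b A A' B \<theta> (r i)) else 0)"

text \<open>
  \<open>R 1, \<dots>, R m\<close> are the upper record values of the observations \<open>X 1, \<dots>, X n\<close>, on the event
  that there are exactly \<open>m\<close> of them, and have \<open>g\<close> as joint density. The density is that of the
  first \<open>m\<close> records of an unlimited sequence of observations, not the conditional one given that
  \<open>n\<close> observations produce \<open>m\<close> records. Hence \<open>R\<close> lives on the whole probability space, and is
  constrained outside that event only by its joint law.
\<close>

definition upper_record_values ::
    "'w measure \<Rightarrow> ((nat \<Rightarrow> real) \<Rightarrow> real) \<Rightarrow> nat \<Rightarrow> (nat \<Rightarrow> 'w \<Rightarrow> real) \<Rightarrow> nat \<Rightarrow> (nat \<Rightarrow> 'w \<Rightarrow> real) \<Rightarrow> bool" where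
  "upper_record_values M g n X m R \<longleftrightarrow>
     (AE \<omega> in M. length (upper_records (map (\<lambda>i. X i \<omega>) [1..<Suc n])) = m \<longrightarrow>
        upper_records (map (\<lambda>i. X i \<omega>) [1..<Suc n]) = map (\<lambda>i. R i \<omega>) [1..<Suc m]) \<and>
     distributed M (Pi\<^sub>M {1..m} (\<lambda>_. lborel)) (\<lambda>\<omega>. \<lambda>i\<in>{1..m}. R i \<omega>) (\<lambda>r. ennreal (g r))"

definition mle_pdf_sample :: "(real \<Rightarrow> real) \<Rightarrow> (real \<Rightarrow> real) \<Rightarrow> nat \<Rightarrow> (nat \<Rightarrow> real) \<Rightarrow> real \<Rightarrow> real" where
  "mle_pdf_sample A A' k xs x =
     real k * A' x / (\<Sum>i=1..k. A (xs i)) * exp (- (real k * A x / (\<Sum>i=1..k. A (xs i))))"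

definition mle_cdf_sample :: "(real \<Rightarrow> real) \<Rightarrow> nat \<Rightarrow> (nat \<Rightarrow> real) \<Rightarrow> real \<Rightarrow> real" where
  "mle_cdf_sample A k xs x = 1 - exp (- (real k * A x / (\<Sum>i=1..k. A (xs i))))"

definition mle_pdf_records :: "(real \<Rightarrow> real) \<Rightarrow> (real \<Rightarrow> real) \<Rightarrow> nat \<Rightarrow> (nat \<Rightarrow> real) \<Rightarrow> real \<Rightarrow> real" where
  "mle_pdf_records A A' m rs x =
     real m * A' x / A (rs m) * exp (- (real m * A x / A (rs m)))"

definition mle_cdf_records :: "(real \<Rightarrow> real) \<Rightarrow> nat \<Rightarrow> (nat \<Rightarrow> real) \<Rightarrow> real \<Rightarrow> real" where
  "mle_cdf_records A m rs x = 1 - exp (- (real m * A x / A (rs m)))"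

end

theory Submission
  imports Defs "HOL-Real_Asymp.Real_Asymp"
begin

text \<open>
  Both estimators are the same function of one statistic: \<open>A (R m)\<close> for the records and the sum of the
  \<open>A (Y i)\<close> for the sample. Each \<open>A (Y i)\<close> is exponential with rate \<open>B \<theta>\<close>, so the sum is Erlang
  distributed. For the records, integrating out \<open>r 1 < \<dots> < r k\<close> below \<open>s\<close> against \<open>\<Prod> A' (r i)\<close>
  leaves \<open>A s ^ k / k!\<close>, so the distribution function of \<open>A (R m)\<close> is again the Erlang one.
\<close>

section \<open>Calculus and measure theory independent of the family\<close>

text \<open>The derivatives of the summands telescope, so only the last one survives. The bare
  formula replaces \<open>erlang_CDF\<close>, which is cut off to 0 on negative arguments and can
  have a kink at 0, because \<open>nn_integral_rate\<close> asks for an antiderivative on the whole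
  line.\<close>

lemma DERIV_erlang_CDF_formula:
  fixes l :: real
  shows "((\<lambda>u. 1 - (\<Sum>i\<le>k. ((l * u) ^ i * exp (- l * u) / fact i))) has_real_derivative
           l * (l * u) ^ k * exp (- l * u) / fact k) (at u)"
proof (induction k)
  case 0
  show ?case by (auto intro!: derivative_eq_intros)
next
  case (Suc k)
  have "((\<lambda>u. (l * u) ^ Suc k * exp (- l * u)) has_real_derivative
      real (Suc k) * l * (l * u) ^ k * exp (- l * u) - l * (l * u) ^ Suc k * exp (- l * u)) (at u)"
    by (rule derivative_eq_intros refl | simp add: algebra_simps)+
  from DERIV_diff[OF Suc DERIV_cdivide[OF this, of "fact (Suc k)"]] show ?case
    by (simp add: diff_divide_distrib diff_diff_eq del: power_Suc of_nat_Suc)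
qed

text \<open>Hyperplanes are null sets. Taken with the end point \<open>a\<close> as
  \<open>c\<close>, this discards the points where \<open>ef_pdf\<close> uses the arbitrary value
  \<open>A' a\<close> while \<open>rate\<close> is 0.\<close>

lemma AE_component_neq:
  assumes "finite I"
  shows "AE r in Pi\<^sub>M I (\<lambda>_::nat. lborel). \<forall>i\<in>I. r i \<noteq> (c::real)"
proof -
  interpret P: product_sigma_finite "\<lambda>_::nat. lborel :: real measure" ..
  have "AE r in Pi\<^sub>M I (\<lambda>_::nat. lborel). r i \<noteq> c" if i: "i \<in> I" for i
  proof (rule AE_I)
    let ?S = "\<lambda>j. if j = i then {c} else UNIV"
    show "{r \<in> space (Pi\<^sub>M I (\<lambda>_. lborel)). \<not> r i \<noteq> c} \<subseteq> Pi\<^sub>E I ?S"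
      by (auto simp: space_PiM PiE_def Pi_def)
    \<comment> \<open>The other factors have infinite measure, but in \<open>ennreal\<close> a
      product with a zero factor is 0.\<close>
    show "emeasure (Pi\<^sub>M I (\<lambda>_. lborel)) (Pi\<^sub>E I ?S) = 0"
      using assms i by (subst P.emeasure_PiM) (auto intro!: prod_zero bexI[of _ i])
    show "Pi\<^sub>E I ?S \<in> sets (Pi\<^sub>M I (\<lambda>_. lborel))"
      using assms by (intro sets_PiM_I_finite) auto
  qed
  then show ?thesis using assms by (intro AE_finite_allI)
qed

lemma distr_compose_eq:
  assumes "distributed M lborel U f" "distributed N lborel V f" "g \<in> borel_measurable borel"
  shows "distr M borel (\<lambda>\<omega>. g (U \<omega>)) = distr N borel (\<lambda>\<omega>. g (V \<omega>))"
proof -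
  have "distr M lborel U = distr N lborel V"
    using assms by (simp add: distributed_distr_eq_density)
  then have "distr (distr M lborel U) borel g = distr (distr N lborel V) borel g"
    by simp
  then show ?thesis
    using assms distributed_measurable[OF assms(1)] distributed_measurable[OF assms(2)]
    by (simp add: distr_distr comp_def)
qed

section \<open>Behaviour of \<open>A\<close> and its derivative on the support\<close>

context exp_family_first_type
begin

text \<open>The value of \<open>A'\<close> at the end point \<open>a\<close> is arbitrary, possibly negative, hence the strict inequality.\<close>

definition rate :: "real \<Rightarrow> real" where
  "rate y = (if a < y \<and> ereal y < b then A' y else 0)"

lemma A_mono': "a \<le> x \<Longrightarrow> x \<le> y \<Longrightarrow> ereal y < b \<Longrightarrow> A x \<le> A y"
  using A_mono order.strict_trans1[of "ereal x" "ereal y" b] unfolding mono_on_def by auto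

lemma A_nonneg: "a \<le> x \<Longrightarrow> ereal x < b \<Longrightarrow> 0 \<le> A x"
  using A_mono'[of a x] A_left by simp

text \<open>At \<open>a\<close> there is only continuity from the right, hence the closed intervals
  starting at \<open>a\<close>; at the other points differentiability gives it.\<close>

lemma continuous_on_A:
  assumes "ereal c < b"
  shows "continuous_on {a..c} A"
proof -
  have "continuous (at x within {a..c}) A" if x: "a \<le> x" "x \<le> c" for x
  proof (cases "x = a")
    case True
    have "continuous (at a within {a..}) A"
      using A_cont by (simp add: continuous_within at_within_Ici_at_right)
    then show ?thesis
      unfolding True by (rule continuous_within_subset) auto
  next
    case False
    then have "ereal x < b" using x assms order.strict_trans1[of "ereal x" "ereal c" b] by auto
    then have "isCont A x" using False x by (intro DERIV_isCont[OF A_deriv]) auto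
    then show ?thesis by (rule continuous_at_imp_continuous_at_within)
  qed
  then show ?thesis by (auto simp: continuous_on_eq_continuous_within)
qed

text \<open>\<open>A\<close> may be constant on stretches, so the level set of \<open>t\<close> can
  be an interval; its largest point turns \<open>A y \<le> t\<close> into a half-line. The level set
  is nonempty by the intermediate value theorem, and compact once cut at a point where
  \<open>A\<close> exceeds \<open>t\<close>.\<close>

lemma quantile_exists:
  assumes "0 \<le> t"
  obtains c where "a \<le> c" "ereal c < b" "A c = t"
    "\<And>y. a \<le> y \<Longrightarrow> ereal y < b \<Longrightarrow> A y \<le> t \<longleftrightarrow> y \<le> c"
proof -
  have "eventually (\<lambda>z. t < (A \<circ> real_of_ereal) z) (at_left b)"
    using A_right by (simp add: filterlim_at_top_dense)
  then obtain z where z: "z < b" "\<And>y. z < y \<Longrightarrow> y < b \<Longrightarrow> t < A (real_of_ereal y)"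
    unfolding eventually_at_left[OF a_less_b] by auto
  \<comment> \<open>Strictly between \<open>a\<close> and \<open>b\<close>, this \<open>y\<close> is
    a finite extended real and yields a real point \<open>x\<close> of the support with
    \<open>t < A x\<close>.\<close>
  obtain y where y: "max z (ereal a) < y" "y < b"
    using z a_less_b dense[of "max z (ereal a)" b] by auto
  obtain x where "y = ereal x" using y by (cases y) auto
  with y z(2)[of y] have x: "a < x" "ereal x < b" "t < A x" by auto
  define S where "S = {y\<in>{a..x}. A y = t}"
  have "closed S"
    unfolding S_def by (rule continuous_closed_preimage_constant[OF continuous_on_A[OF x(2)]]) simp
  moreover have "bounded S"
    by (rule bounded_subset[of "{a..x}"]) (auto simp: S_def)
  ultimately have "compact S"
    by (simp add: compact_eq_bounded_closed)
  moreover have "S \<noteq> {}"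
    using IVT'[of A a t x] x assms continuous_on_A[OF x(2)] A_left by (auto simp: S_def)
  ultimately obtain c where c: "c \<in> S" "\<And>y. y \<in> S \<Longrightarrow> y \<le> c"
    using compact_attains_sup[of S] by metis
  have cx: "a \<le> c" "c \<le> x" "A c = t" using c by (auto simp: S_def)
  have cb: "ereal c < b" using cx x order.strict_trans1[of "ereal c" "ereal x" b] by auto
  have "A y \<le> t \<longleftrightarrow> y \<le> c" if y: "a \<le> y" "ereal y < b" for y
  proof
    assume le: "A y \<le> t"
    \<comment> \<open>A point \<open>y\<close> beyond \<open>c\<close> with
      \<open>A y \<le> t\<close> has \<open>A y = t\<close> by monotonicity and is at most
      \<open>x\<close> since \<open>t < A x\<close>, against the maximality of
      \<open>c\<close>.\<close>
    show "y \<le> c"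
    proof (rule ccontr)
      assume nle: "\<not> y \<le> c"
      then have "A y = t" using A_mono'[of c y] cx y le by auto
      moreover have "y \<le> x" using A_mono'[of x y] x y le by force
      ultimately show False using c(2)[of y] y nle by (auto simp: S_def)
    qed
  next
    assume "y \<le> c" then show "A y \<le> t" using A_mono'[of y c] cx cb y by auto
  qed
  then show thesis by (rule that[OF cx(1) cb cx(3)])
qed

lemma A'_nonneg:
  assumes "a < x" "ereal x < b"
  shows "0 \<le> A' x"
proof -
  have "open {y. a < y \<and> ereal y < b}"
    by (intro open_Collect_conj open_Collect_less continuous_intros)
  then have "x \<in> interior {y. a \<le> y \<and> ereal y < b}"
    by (rule interiorI) (use assms in auto)
  with A_mono A_deriv[OF assms] show ?thesis
    by (rule mono_on_imp_deriv_nonneg)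
qed

lemma rate_nonneg: "0 \<le> rate x"
  using A'_nonneg by (simp add: rate_def)

text \<open>On the open support \<open>A'\<close> is the pointwise limit of difference quotients of
  the Borel function \<open>A\<close>.\<close>

lemma rate_measurable [measurable]: "rate \<in> borel_measurable borel"
proof (rule borel_measurable_LIMSEQ_real)
  note A_measurable [measurable]
  show "(\<lambda>x. if a < x \<and> ereal x < b then (A (x + 1 / real (Suc n)) - A x) / (1 / real (Suc n)) else 0)
      \<in> borel_measurable borel" for n
    by measurable
  show "(\<lambda>n. if a < x \<and> ereal x < b then (A (x + 1 / real (Suc n)) - A x) / (1 / real (Suc n)) else 0)
      \<longlonglongrightarrow> rate x" for x
  proof (cases "a < x \<and> ereal x < b")
    case True
    then have "((\<lambda>h. (A (x + h) - A x) / h) \<longlongrightarrow> A' x) (at 0)"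
      using A_deriv[of x] by (simp add: DERIV_def)
    moreover have "filterlim (\<lambda>n. 1 / real (Suc n)) (at 0) sequentially"
      using LIMSEQ_Suc[OF lim_1_over_n] by (auto simp: filterlim_at eventually_sequentially)
    ultimately have "(\<lambda>n. (A (x + 1 / real (Suc n)) - A x) / (1 / real (Suc n))) \<longlonglongrightarrow> A' x"
      by (rule filterlim_compose)
    with True show ?thesis by (simp only: rate_def if_True simp_thms)
  qed (auto simp: rate_def)
qed

section \<open>Integration against \<open>rate\<close> and over increasing chains\<close>

text \<open>The substitution \<open>u = A y\<close>, obtained from the fundamental theorem of
  calculus for \<open>\<Phi> \<circ> A\<close>, which copes with a non-injective
  \<open>A\<close>.\<close>

lemma nn_integral_rate:
  assumes c: "a \<le> c" "ereal c < b"
    and \<Phi>: "\<And>u. (\<Phi> has_real_derivative \<phi> u) (at u)"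
    and \<phi>: "\<And>u. 0 \<le> u \<Longrightarrow> 0 \<le> \<phi> u"
  shows "(\<integral>\<^sup>+y. ennreal (rate y * \<phi> (A y)) * indicator {..c} y \<partial>lborel) = ennreal (\<Phi> (A c) - \<Phi> 0)"
proof -
  have \<Phi>c: "continuous_on UNIV \<Phi>"
    by (rule continuous_at_imp_continuous_on) (use DERIV_isCont[OF \<Phi>] in blast)
  have less: "ereal x < b" if "x \<le> c" for x
    using that c order.strict_trans1[of "ereal x" "ereal c" b] by auto
  have "((\<lambda>y. rate y * \<phi> (A y)) has_integral ((\<Phi> \<circ> A) c - (\<Phi> \<circ> A) a)) {a..c}"
  \<comment> \<open>The interior version asks only for continuity at the end points;
    \<open>A\<close> may fail to be differentiable at \<open>a\<close>.\<close>
  proof (rule fundamental_theorem_of_calculus_interior[OF c(1)])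
    show "continuous_on {a..c} (\<Phi> \<circ> A)"
      by (intro continuous_on_compose continuous_on_A c continuous_on_subset[OF \<Phi>c]) auto
    show "((\<Phi> \<circ> A) has_vector_derivative rate x * \<phi> (A x)) (at x)" if x: "x \<in> {a<..<c}" for x
    proof -
      have "a < x" "ereal x < b" using x less[of x] by auto
      then show ?thesis
        using DERIV_chain[OF \<Phi> A_deriv[of x]]
        by (simp add: rate_def has_real_derivative_iff_has_vector_derivative mult.commute)
    qed
  qed
  moreover have "0 \<le> rate y * \<phi> (A y)" if "y \<in> {a..c}" for y
    using that less[of y] by (intro mult_nonneg_nonneg rate_nonneg \<phi> A_nonneg) auto
  \<comment> \<open>Nonnegativity turns the gauge integral into a Lebesgue integral.\<close>
  ultimately have "(\<integral>\<^sup>+y. ennreal (indicator {a..c} y * (rate y * \<phi> (A y))) \<partial>lborel) = ennreal (\<Phi> (A c) - \<Phi> 0)"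
    using nn_integral_has_integral_lebesgue[of "{a..c}" "\<lambda>y. rate y * \<phi> (A y)"] by (simp add: A_left)
  also have "(\<integral>\<^sup>+y. ennreal (indicator {a..c} y * (rate y * \<phi> (A y))) \<partial>lborel) =
     (\<integral>\<^sup>+y. ennreal (rate y * \<phi> (A y)) * indicator {..c} y \<partial>lborel)"
    by (intro nn_integral_cong) (auto simp: indicator_def rate_def)
  finally show ?thesis .
qed

text \<open>For \<open>s\<close> in the support, substituting \<open>u i = A (r i)\<close> makes
  this the volume of the ordered simplex below \<open>A s\<close>.\<close>

definition chain_integral :: "nat \<Rightarrow> real \<Rightarrow> ennreal" where
  "chain_integral k s = (\<integral>\<^sup>+r. (if strict_mono_on {1..k} r \<and> (\<forall>i\<in>{1..k}. r i < s)
     then \<Prod>i\<in>{1..k}. ennreal (rate (r i)) else 0) \<partial>Pi\<^sub>M {1..k} (\<lambda>_. lborel))"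

text \<open>Tonelli with the largest coordinate outermost: once it is fixed as \<open>y\<close>, the
  others form an increasing chain below \<open>y\<close>. The general weight \<open>\<psi>\<close>
  serves both the recursion for \<open>chain_integral\<close> and the law of the last
  record.\<close>

lemma nn_integral_increasing_Suc:
  assumes \<psi> [measurable]: "\<psi> \<in> borel_measurable borel"
  shows "(\<integral>\<^sup>+r. (if strict_mono_on {1..Suc k} r
      then \<psi> (r (Suc k)) * (\<Prod>i\<in>{1..Suc k}. ennreal (rate (r i))) else 0) \<partial>Pi\<^sub>M {1..Suc k} (\<lambda>_. lborel)) =
    (\<integral>\<^sup>+y. \<psi> y * ennreal (rate y) * chain_integral k y \<partial>lborel)"
proof -
  interpret P: product_sigma_finite "\<lambda>_::nat. lborel :: real measure" ..
  have I: "{1..Suc k} = insert (Suc k) {1..k}" by auto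
  define F where "F r = (if strict_mono_on {1..Suc k} r
      then \<psi> (r (Suc k)) * (\<Prod>i\<in>{1..Suc k}. ennreal (rate (r i))) else 0)" for r
  define G where "G y r = (if strict_mono_on {1..k} r \<and> (\<forall>i\<in>{1..k}. r i < y)
      then \<Prod>i\<in>{1..k}. ennreal (rate (r i)) else 0)" for y r
  have comp [measurable]: "i \<in> J \<Longrightarrow> (\<lambda>r. r i) \<in> borel_measurable (Pi\<^sub>M J (\<lambda>_. lborel))" for i :: nat and J
    by (subst measurable_lborel1[symmetric]) (rule measurable_component_singleton)
  \<comment> \<open>Over pairs of indices, strict monotonicity is a finite conjunction of coordinate
    comparisons.\<close>
  have [measurable]: "Measurable.pred (Pi\<^sub>M {1..j} (\<lambda>_. lborel)) (strict_mono_on {1..j} :: (nat \<Rightarrow> real) \<Rightarrow> bool)" for j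
  proof -
    have "Measurable.pred (Pi\<^sub>M {1..j} (\<lambda>_. lborel)) (\<lambda>r::nat \<Rightarrow> real. \<forall>i\<in>{1..j}. \<forall>l\<in>{1..j}. i < l \<longrightarrow> r i < r l)"
      by (intro pred_intros_finite pred_intros_logic borel_measurable_pred_less comp) auto
    moreover have "strict_mono_on {1..j} = (\<lambda>r::nat \<Rightarrow> real. \<forall>i\<in>{1..j}. \<forall>l\<in>{1..j}. i < l \<longrightarrow> r i < r l)"
      by (simp add: fun_eq_iff monotone_on_def)
    ultimately show ?thesis by simp
  qed
  have F: "F \<in> borel_measurable (Pi\<^sub>M {1..Suc k} (\<lambda>_. lborel))"
    unfolding F_def by measurable
  have [measurable]: "G y \<in> borel_measurable (Pi\<^sub>M {1..k} (\<lambda>_. lborel))" for y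
  proof -
    have [measurable]: "Measurable.pred (Pi\<^sub>M {1..k} (\<lambda>_. lborel)) (\<lambda>r::nat \<Rightarrow> real. \<forall>i\<in>{1..k}. r i < y)"
      by (intro pred_intros_finite borel_measurable_pred_less comp) auto
    show ?thesis unfolding G_def by measurable
  qed
  have upd: "F (r(Suc k := y)) = \<psi> y * ennreal (rate y) * G y r" for r y
  proof -
    have "strict_mono_on {1..Suc k} (r(Suc k := y)) \<longleftrightarrow> strict_mono_on {1..k} r \<and> (\<forall>i\<in>{1..k}. r i < y)"
      unfolding monotone_on_def I by auto
    moreover have "(\<Prod>i\<in>{1..k}. ennreal (rate ((r(Suc k := y)) i))) = (\<Prod>i\<in>{1..k}. ennreal (rate (r i)))"
      by (intro prod.cong) auto
    ultimately show ?thesis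
      by (simp add: F_def G_def mult_ac)
  qed
  have "integral\<^sup>N (Pi\<^sub>M {1..Suc k} (\<lambda>_. lborel)) F =
      (\<integral>\<^sup>+y. (\<integral>\<^sup>+r. F (r(Suc k := y)) \<partial>Pi\<^sub>M {1..k} (\<lambda>_. lborel)) \<partial>lborel)"
    unfolding I by (rule P.product_nn_integral_insert_rev[OF _ _ F[unfolded I]]) auto
  also have "\<dots> = (\<integral>\<^sup>+y. \<psi> y * ennreal (rate y) * chain_integral k y \<partial>lborel)"
  proof (rule nn_integral_cong)
    fix y
    have "(\<integral>\<^sup>+r. F (r(Suc k := y)) \<partial>Pi\<^sub>M {1..k} (\<lambda>_. lborel)) =
        \<psi> y * ennreal (rate y) * (\<integral>\<^sup>+r. G y r \<partial>Pi\<^sub>M {1..k} (\<lambda>_. lborel))"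
      unfolding upd by (rule nn_integral_cmult) measurable
    then show "(\<integral>\<^sup>+r. F (r(Suc k := y)) \<partial>Pi\<^sub>M {1..k} (\<lambda>_. lborel)) =
        \<psi> y * ennreal (rate y) * chain_integral k y"
      by (simp only: chain_integral_def G_def)
  qed
  finally show ?thesis by (simp add: F_def[abs_def])
qed

text \<open>Induction on the chain length: integrating \<open>A y ^ k / fact k\<close> against
  \<open>rate\<close> up to \<open>s\<close> raises the power by one.\<close>

lemma chain_integral_eq:
  assumes "a \<le> s" "ereal s < b"
  shows "chain_integral k s = ennreal (A s ^ k / fact k)"
  using assms
proof (induction k arbitrary: s)
  case 0
  interpret P: product_sigma_finite "\<lambda>_::nat. lborel :: real measure" ..
  show ?case by (simp add: chain_integral_def P.nn_integral_empty PiM_empty)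
next
  case (Suc k)
  have less: "ereal x < b" if "x \<le> s" for x
    using that Suc.prems order.strict_trans1[of "ereal x" "ereal s" b] by auto
  \<comment> \<open>In an increasing chain the bound by \<open>s\<close> needs checking only at the
    top, so it can act as the weight \<open>\<psi>\<close>.\<close>
  have "strict_mono_on {1..Suc k} r \<and> (\<forall>i\<in>{1..Suc k}. r i < s) \<longleftrightarrow>
      strict_mono_on {1..Suc k} r \<and> r (Suc k) < s" for r
  proof -
    have "r i < s" if "strict_mono_on {1..Suc k} r" "r (Suc k) < s" "i \<in> {1..Suc k}" for i
      using monotone_onD[OF that(1,3), of "Suc k"] that by (cases "i = Suc k") auto
    then show ?thesis by auto
  qed
  then have "chain_integral (Suc k) s = (\<integral>\<^sup>+r. (if strict_mono_on {1..Suc k} r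
      then indicator {..<s} (r (Suc k)) * (\<Prod>i\<in>{1..Suc k}. ennreal (rate (r i))) else 0) \<partial>Pi\<^sub>M {1..Suc k} (\<lambda>_. lborel))"
    unfolding chain_integral_def by (intro nn_integral_cong) (simp add: indicator_def)
  also have "\<dots> = (\<integral>\<^sup>+y. indicator {..<s} y * ennreal (rate y) * chain_integral k y \<partial>lborel)"
    by (rule nn_integral_increasing_Suc) measurable
  \<comment> \<open>The two indicators differ only at the null point \<open>s\<close>; up to
    \<open>a\<close> both sides vanish through \<open>rate\<close>.\<close>
  also have "\<dots> = (\<integral>\<^sup>+y. ennreal (rate y * (A y ^ k / fact k)) * indicator {..s} y \<partial>lborel)"
  proof (rule nn_integral_cong_AE)
    have eq: "indicator {..<s} y * ennreal (rate y) * chain_integral k y =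
        ennreal (rate y * (A y ^ k / fact k)) * indicator {..s} y" if "y \<noteq> s" for y
    proof (cases "a < y \<and> y < s")
      case True
      then show ?thesis
        using Suc.IH[of y] less[of y] rate_nonneg A_nonneg[of y] by (simp flip: ennreal_mult)
    qed (use that in \<open>auto simp: rate_def indicator_def\<close>)
    show "AE y in lborel. indicator {..<s} y * ennreal (rate y) * chain_integral k y =
        ennreal (rate y * (A y ^ k / fact k)) * indicator {..s} y"
      using AE_lborel_singleton[of s] by eventually_elim (rule eq)
  qed
  \<comment> \<open>The subtracted term is the antiderivative at \<open>A a = 0\<close>.\<close>
  also have "\<dots> = ennreal (A s ^ Suc k / fact (Suc k) - 0 ^ Suc k / fact (Suc k))"
  proof (rule nn_integral_rate[OF Suc.prems])
    have "((\<lambda>u. u ^ Suc k) has_real_derivative real (Suc k) * u ^ k) (at u)" for u :: real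
      using DERIV_pow[of "Suc k" u] by simp
    from DERIV_cdivide[OF this, of "fact (Suc k)"]
    show "((\<lambda>u. u ^ Suc k / fact (Suc k)) has_real_derivative u ^ k / fact k) (at u)" for u :: real
      by (simp del: power_Suc of_nat_Suc)
  qed simp
  finally show ?case by simp
qed

section \<open>Laws of \<open>A\<close> at the last record and at a single observation\<close>

context
  fixes \<theta> assumes \<theta>: "\<theta> \<in> \<Theta>"
begin

text \<open>In each hazard the survival factor cancels, so the only exponential left comes from the
  density of the last record.\<close>

lemma record_density_eq:
  assumes "\<forall>i\<in>{1..Suc k}. r i \<noteq> a" "strict_mono_on {1..Suc k} r"
  shows "record_density a b A A' B \<theta> (Suc k) r =
    B \<theta> ^ Suc k * exp (- B \<theta> * A (r (Suc k))) * (\<Prod>i\<in>{1..Suc k}. rate (r i))"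
proof -
  have pdf: "ef_pdf a b A A' B \<theta> y = rate y * B \<theta> * exp (- B \<theta> * A y)" if "y \<noteq> a" for y
    using that by (auto simp: ef_pdf_def rate_def mult.commute)
  \<comment> \<open>From \<open>b\<close> onwards the quotient is 0 / 0, which is 0 by convention
    and agrees with \<open>rate\<close>.\<close>
  have "ef_hazard a b A A' B \<theta> y = B \<theta> * rate y" if "y \<noteq> a" for y
    using that by (auto simp: ef_hazard_def pdf ef_cdf_def rate_def)
  then have "(\<Prod>i\<in>{1..<Suc k}. ef_hazard a b A A' B \<theta> (r i)) = (\<Prod>i\<in>{1..k}. B \<theta> * rate (r i))"
    using assms(1) by (intro prod.cong) auto
  also have "\<dots> = B \<theta> ^ k * (\<Prod>i\<in>{1..k}. rate (r i))"
    by (simp add: prod.distrib)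
  finally show ?thesis
    using assms pdf[of "r (Suc k)"] by (simp add: record_density_def)
qed

text \<open>By \<open>erlang_distributedI\<close> the distribution function at
  \<open>t \<ge> 0\<close> suffices. The earlier records are integrated out by
  \<open>chain_integral\<close>, the last one by substitution.\<close>

lemma distributed_A_last_record:
  assumes D: "distributed M (Pi\<^sub>M {1..Suc k} (\<lambda>_. lborel)) (\<lambda>\<omega>. \<lambda>i\<in>{1..Suc k}. R i \<omega>)
    (\<lambda>r. ennreal (record_density a b A A' B \<theta> (Suc k) r))"
  shows "distributed M lborel (\<lambda>\<omega>. A (R (Suc k) \<omega>)) (erlang_density k (B \<theta>))"
proof (rule erlang_distributedI)
  note A_measurable [measurable]
  have l: "0 < B \<theta>" using B_pos \<theta> .
  then show "0 < B \<theta>" .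
  have comp [measurable]: "(\<lambda>r. r (Suc k)) \<in> borel_measurable (Pi\<^sub>M {1..Suc k} (\<lambda>_. lborel))"
    by (subst measurable_lborel1[symmetric]) (rule measurable_component_singleton, simp)
  from measurable_compose[OF distributed_measurable[OF D] comp]
  have [measurable]: "R (Suc k) \<in> borel_measurable M" by simp
  show "(\<lambda>\<omega>. A (R (Suc k) \<omega>)) \<in> borel_measurable M" by measurable
  fix t :: real assume "0 \<le> t"
  then obtain c where c: "a \<le> c" "ereal c < b" "A c = t"
    "\<And>y. a \<le> y \<Longrightarrow> ereal y < b \<Longrightarrow> A y \<le> t \<longleftrightarrow> y \<le> c" by (rule quantile_exists) blast
  have less: "ereal x < b" if "x \<le> c" for x
    using that c order.strict_trans1[of "ereal x" "ereal c" b] by auto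
  \<comment> \<open>The factors depending on the last record alone, apart from its
    \<open>rate\<close>.\<close>
  let ?\<psi> = "\<lambda>y. ennreal (B \<theta> ^ Suc k * exp (- B \<theta> * A y)) * indicator {y. A y \<le> t} y"
  have "emeasure M {\<omega> \<in> space M. A (R (Suc k) \<omega>) \<le> t} = (\<integral>\<^sup>+\<omega>. indicator {y. A y \<le> t} (R (Suc k) \<omega>) \<partial>M)"
  proof -
    have "(\<integral>\<^sup>+\<omega>. indicator {y. A y \<le> t} (R (Suc k) \<omega>) \<partial>M) =
        (\<integral>\<^sup>+\<omega>. indicator {\<omega> \<in> space M. A (R (Suc k) \<omega>) \<le> t} \<omega> \<partial>M)"
      by (intro nn_integral_cong) (simp add: indicator_def)
    also have "\<dots> = emeasure M {\<omega> \<in> space M. A (R (Suc k) \<omega>) \<le> t}"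
      by (rule nn_integral_indicator) measurable
    finally show ?thesis ..
  qed
  also have "\<dots> = (\<integral>\<^sup>+r. ennreal (record_density a b A A' B \<theta> (Suc k) r) * indicator {y. A y \<le> t} (r (Suc k))
      \<partial>Pi\<^sub>M {1..Suc k} (\<lambda>_. lborel))"
  proof -
    have "(\<lambda>r. indicator {y. A y \<le> t} (r (Suc k)) :: ennreal) \<in> borel_measurable (Pi\<^sub>M {1..Suc k} (\<lambda>_. lborel))"
      by (rule measurable_compose[OF comp]) measurable
    from distributed_nn_integral[OF D this] show ?thesis by simp
  qed
  \<comment> \<open>Equality holds off the hyperplanes \<open>r i = a\<close>; without strict
    monotonicity both sides are 0.\<close>
  also have "\<dots> = (\<integral>\<^sup>+r. (if strict_mono_on {1..Suc k} r
      then ?\<psi> (r (Suc k)) * (\<Prod>i\<in>{1..Suc k}. ennreal (rate (r i))) else 0) \<partial>Pi\<^sub>M {1..Suc k} (\<lambda>_. lborel))"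
  proof (rule nn_integral_cong_AE)
    show "AE r in Pi\<^sub>M {1..Suc k} (\<lambda>_. lborel).
        ennreal (record_density a b A A' B \<theta> (Suc k) r) * indicator {y. A y \<le> t} (r (Suc k)) =
        (if strict_mono_on {1..Suc k} r then ?\<psi> (r (Suc k)) * (\<Prod>i\<in>{1..Suc k}. ennreal (rate (r i))) else 0)"
      using AE_component_neq[OF finite_atLeastAtMost, of 1 "Suc k" a]
    proof eventually_elim
      case (elim r)
      show ?case
      proof (cases "strict_mono_on {1..Suc k} r")
        case True
        have "ennreal (record_density a b A A' B \<theta> (Suc k) r) =
            ennreal (B \<theta> ^ Suc k * exp (- B \<theta> * A (r (Suc k)))) * (\<Prod>i\<in>{1..Suc k}. ennreal (rate (r i)))"
          unfolding record_density_eq[OF elim True] prod_ennreal[OF rate_nonneg]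
          by (rule ennreal_mult) (use l in \<open>auto intro!: prod_nonneg rate_nonneg simp del: prod.cl_ivl_Suc\<close>)
        with True show ?thesis by (simp only: if_True mult_ac)
      next
        case False
        then show ?thesis by (simp only: record_density_def if_False ennreal_0 mult_zero_left)
      qed
    qed
  qed
  also have "\<dots> = (\<integral>\<^sup>+y. ?\<psi> y * ennreal (rate y) * chain_integral k y \<partial>lborel)"
    by (rule nn_integral_increasing_Suc) measurable
  \<comment> \<open>Where \<open>rate\<close> is nonzero, \<open>A y \<le> t\<close> means
    \<open>y \<le> c\<close>, and the powers of \<open>B \<theta>\<close> regroup into the Erlang
    density at \<open>A y\<close>.\<close>
  also have "\<dots> = (\<integral>\<^sup>+y. ennreal (rate y * (B \<theta> * (B \<theta> * A y) ^ k * exp (- B \<theta> * A y) / fact k)) * indicator {..c} y \<partial>lborel)"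
  proof (rule nn_integral_cong)
    fix y :: real
    show "?\<psi> y * ennreal (rate y) * chain_integral k y =
        ennreal (rate y * (B \<theta> * (B \<theta> * A y) ^ k * exp (- B \<theta> * A y) / fact k)) * indicator {..c} y"
    proof (cases "a < y \<and> ereal y < b")
      case True
      then have "?\<psi> y * ennreal (rate y) * chain_integral k y =
          ennreal (B \<theta> ^ Suc k * exp (- B \<theta> * A y)) * ennreal (rate y) * ennreal (A y ^ k / fact k) * indicator {..c} y"
        using c(4)[of y] by (simp add: chain_integral_eq indicator_def)
      also have "\<dots> = ennreal (B \<theta> ^ Suc k * exp (- B \<theta> * A y) * rate y * (A y ^ k / fact k)) * indicator {..c} y"
        using l rate_nonneg A_nonneg[of y] True by (simp flip: ennreal_mult)
      finally show ?thesis by (simp add: power_mult_distrib mult_ac)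
    qed (auto simp: rate_def)
  qed
  also have "\<dots> = ennreal ((1 - (\<Sum>i\<le>k. ((B \<theta> * A c) ^ i * exp (- B \<theta> * A c) / fact i))) -
      (1 - (\<Sum>i\<le>k. ((B \<theta> * 0) ^ i * exp (- B \<theta> * 0) / fact i))))"
    by (rule nn_integral_rate[OF c(1,2) DERIV_erlang_CDF_formula]) (use l in simp)
  also have "\<dots> = ennreal (erlang_CDF k (B \<theta>) t)"
  proof -
    \<comment> \<open>Only \<open>i = 0\<close> contributes, as \<open>0 ^ 0 = 1\<close>, so the
      antiderivative vanishes at the lower end.\<close>
    have "(\<Sum>i\<le>k. ((B \<theta> * 0) ^ i * exp (- B \<theta> * 0) / fact i)) = (1::real)"
      by (induction k) auto
    then show ?thesis using c(3) \<open>0 \<le> t\<close> by (simp add: erlang_CDF_def)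
  qed
  finally show "emeasure M {\<omega> \<in> space M. A (R (Suc k) \<omega>) \<le> t} = ennreal (erlang_CDF k (B \<theta>) t)" .
qed

text \<open>Almost surely \<open>Y\<close> lies in the open support, where
  \<open>A (Y \<omega>) \<le> t\<close> means \<open>Y \<omega> \<le> c\<close> for the quantile
  point \<open>c\<close>; the latter probability is read off \<open>ef_cdf\<close>.\<close>

lemma distributed_A_observation:
  assumes "prob_space N" and Y [measurable]: "Y \<in> borel_measurable N"
    and F: "cdf (distr N borel Y) = ef_cdf a b A B \<theta>"
  shows "distributed N lborel (\<lambda>\<omega>. A (Y \<omega>)) (exponential_density (B \<theta>))"
proof -
  interpret N: prob_space N by fact
  note A_measurable [measurable]
  have l: "0 < B \<theta>" using B_pos \<theta> .
  have le: "N.prob {\<omega> \<in> space N. Y \<omega> \<le> y} = ef_cdf a b A B \<theta> y" for y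
    unfolding F[symmetric] by (simp add: cdf_def measure_distr vimage_def Int_def conj_commute)
  have "N.prob {\<omega> \<in> space N. Y \<omega> \<le> a} = 0"
    unfolding le using a_less_b A_left by (simp add: ef_cdf_def)
  then have lower: "AE \<omega> in N. a < Y \<omega>"
    by (subst (asm) N.prob_Collect_eq_0) (auto simp: not_le)
  have upper: "AE \<omega> in N. ereal (Y \<omega>) < b"
  proof -
    let ?p = "N.prob {\<omega> \<in> space N. ereal (Y \<omega>) < b}"
    \<comment> \<open>The event contains \<open>Y \<omega> \<le> c\<close> whenever
      \<open>A c = t\<close>; letting \<open>t\<close> grow forces probability 1, for finite and
      infinite \<open>b\<close> alike.\<close>
    have "1 - exp (- B \<theta> * t) \<le> ?p" if "0 \<le> t" for t
    proof -
      obtain c where c: "a \<le> c" "ereal c < b" "A c = t"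
        using quantile_exists[OF \<open>0 \<le> t\<close>] by metis
      then have "1 - exp (- B \<theta> * t) = N.prob {\<omega> \<in> space N. Y \<omega> \<le> c}"
        unfolding le by (simp add: ef_cdf_def)
      also have "\<dots> \<le> ?p"
      proof (rule N.finite_measure_mono)
        show "{\<omega> \<in> space N. Y \<omega> \<le> c} \<subseteq> {\<omega> \<in> space N. ereal (Y \<omega>) < b}"
          using c(2) by (auto intro: order.strict_trans1[of _ "ereal c" b])
      qed measurable
      finally show ?thesis .
    qed
    then have "eventually (\<lambda>t. 1 - exp (- B \<theta> * t) \<le> ?p) at_top"
      by (rule eventually_mono[OF eventually_ge_at_top])
    moreover have "((\<lambda>t. 1 - exp (- B \<theta> * t)) \<longlongrightarrow> 1) at_top"
      using l by real_asymp
    ultimately have "1 \<le> ?p"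
      by (intro tendsto_upperbound[of "\<lambda>t. 1 - exp (- B \<theta> * t)" 1 at_top]) auto
    then have "?p = 1" using N.prob_le_1 by (intro antisym) auto
    then show ?thesis by (subst (asm) N.prob_Collect_eq_1) auto
  qed
  show ?thesis
  \<comment> \<open>The exponential law is the Erlang law of index 0.\<close>
  proof (rule erlang_distributedI[OF _ l])
    fix t :: real assume "0 \<le> t"
    then obtain c where c: "a \<le> c" "ereal c < b" "A c = t"
      "\<And>y. a \<le> y \<Longrightarrow> ereal y < b \<Longrightarrow> A y \<le> t \<longleftrightarrow> y \<le> c" by (rule quantile_exists) blast
    have "N.prob {\<omega> \<in> space N. A (Y \<omega>) \<le> t} = N.prob {\<omega> \<in> space N. Y \<omega> \<le> c}"
    proof (rule N.finite_measure_eq_AE)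
      show "AE \<omega> in N. \<omega> \<in> {\<omega> \<in> space N. A (Y \<omega>) \<le> t} \<longleftrightarrow> \<omega> \<in> {\<omega> \<in> space N. Y \<omega> \<le> c}"
        using lower upper by eventually_elim (use c(4) in auto)
    qed measurable
    also have "\<dots> = erlang_CDF 0 (B \<theta>) t"
      unfolding le using c \<open>0 \<le> t\<close> by (simp add: ef_cdf_def erlang_CDF_0)
    finally show "emeasure N {\<omega> \<in> space N. A (Y \<omega>) \<le> t} = ennreal (erlang_CDF 0 (B \<theta>) t)"
      by (simp add: N.emeasure_eq_measure)
  qed measurable
qed

end

end

section \<open>Equality in law of the two pairs of estimators\<close>

theorem theorem2:
  fixes a :: real and b :: ereal and A A' B :: "real \<Rightarrow> real" and \<Theta> :: "real set" and \<theta> :: real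
    and M :: "'w measure" and N :: "'v measure" and n m :: nat
    and X R :: "nat \<Rightarrow> 'w \<Rightarrow> real" and Y :: "nat \<Rightarrow> 'v \<Rightarrow> real"
  assumes "exp_family_first_type a b A A' \<Theta> B"
    and "\<theta> \<in> \<Theta>"
    and "1 \<le> m" and "m \<le> n"
    and "random_sample M (ef_cdf a b A B \<theta>) n X"
    and "upper_record_values M (record_density a b A A' B \<theta> m) n X m R"
    and "random_sample N (ef_cdf a b A B \<theta>) m Y"
  shows "\<forall>x. distr M borel (\<lambda>\<omega>. mle_pdf_records A A' m (\<lambda>i. R i \<omega>) x) =
             distr N borel (\<lambda>\<omega>. mle_pdf_sample A A' m (\<lambda>i. Y i \<omega>) x) \<and>
             distr M borel (\<lambda>\<omega>. mle_cdf_records A m (\<lambda>i. R i \<omega>) x) =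
             distr N borel (\<lambda>\<omega>. mle_cdf_sample A m (\<lambda>i. Y i \<omega>) x)"
proof -
  interpret exp_family_first_type a b A A' \<Theta> B by fact
  \<comment> \<open>The index of \<open>erlang_density\<close> is the shape minus one, hence the
    predecessor of \<open>m\<close>.\<close>
  obtain k where m: "m = Suc k" using assms(3) by (cases m) auto
  interpret N: prob_space N using assms(7) by (simp add: random_sample_def)
  note A_measurable [measurable]
  have indep: "N.indep_vars (\<lambda>_. borel) Y {1..m}"
    and F: "\<And>i. i \<in> {1..m} \<Longrightarrow> cdf (distr N borel (Y i)) = ef_cdf a b A B \<theta>"
    using assms(7) by (auto simp: random_sample_def)
  have "distributed N lborel (\<lambda>\<omega>. A (Y i \<omega>)) (exponential_density (B \<theta>))" if "i \<in> {1..m}" for i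
    using indep that F[OF that]
    by (intro distributed_A_observation assms(2) N.prob_space_axioms) (auto simp: N.indep_vars_def)
  moreover have "N.indep_vars (\<lambda>_. borel) (\<lambda>i \<omega>. A (Y i \<omega>)) {1..m}"
    by (rule N.indep_vars_compose2[OF indep]) measurable
  ultimately have sample: "distributed N lborel (\<lambda>\<omega>. \<Sum>i=1..m. A (Y i \<omega>)) (erlang_density k (B \<theta>))"
    using N.exponential_distributed_sum[of "{1..m}" "B \<theta>" "\<lambda>i \<omega>. A (Y i \<omega>)"] B_pos[OF assms(2)] m by simp
  have records: "distributed M lborel (\<lambda>\<omega>. A (R m \<omega>)) (erlang_density k (B \<theta>))"
    using assms(6) unfolding m upper_record_values_def
    by (intro distributed_A_last_record assms(2)) auto
  show ?thesis
    \<comment> \<open>For fixed \<open>x\<close>, \<open>A x\<close> and \<open>A' x\<close> are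
      constants, so each estimator is a Borel function of its statistic \<open>s\<close>, with the
      same convention for division by 0 on both sides.\<close>
    unfolding mle_pdf_records_def mle_pdf_sample_def mle_cdf_records_def mle_cdf_sample_def
    by (intro allI conjI
        distr_compose_eq[OF records sample, of "\<lambda>s. real m * A' _ / s * exp (- (real m * A _ / s))"]
        distr_compose_eq[OF records sample, of "\<lambda>s. 1 - exp (- (real m * A _ / s))"]) measurable
qed

end
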